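(* Let the primal problem (P), the Lagrangian $L$, the dual function $L^\ast$, the dual problem (D) and the subgradient procedure be as defined in the context. Then the following hold. (i) $L^\ast(\cdot)$ is finite and convex everywhere on $\mathbb{R}^{|\mathcal{K}|}$. (ii) For any $\lambda\in\mathbb{R}^{|\mathcal{K}|}$ such that $0\le\lambda_k\le 1$ for all $k\in\mathcal{K}$, the subgradient procedure with input $\lambda$ computes a valid subgradient of $L^\ast$ at $\lambda$, i.e. its output $g(\lambda)$ satisfies $g(\lambda)\in\partial L^\ast(\lambda)$. (iii) Let $P^\ast$ denote the optimal objective function value of the primal problem (P) and $D^\ast$ the optimal objective function value of the dual problem (D). Then for any $(\mathbf{x},\mathbf{b})$ that is feasible for (P) and any $\lambda$ that is feasible for (D), $$\pi(\mathbf{x},\mathbf{b})\le P^\ast\le D^\ast\le L^\ast(\lambda).$$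
   Context: Let $\mathcal{I}$ (impression types) and $\mathcal{K}$ (campaigns) be finite sets. For each $k\in\mathcal{K}$ let $\mathcal{I}_k\subseteq\mathcal{I}$ be the set of impression types targeted by campaign $k$, and let $m_k\ge 0$ be its budget. Put $\mathcal{E}:=\{(i,k)\in\mathcal{I}\times\mathcal{K}: i\in\mathcal{I}_k\}$ and, for $i\in\mathcal{I}$, $\mathcal{K}_i:=\{k\in\mathcal{K}:(i,k)\in\mathcal{E}\}$. For each $i\in\mathcal{I}$, $s_i\ge 0$ is a (finite) real number (the mean number of arrivals of impressions of type $i$), and $B^{\max}_i$ is a real-valued random variable with $B^{\max}_i>0$ with probability one. Its cumulative distribution function is $\rho_i(b):=\mathbb{P}(B^{\max}_i\le b)$, and $\beta^{\max}_i(b):=\mathbb{E}[B^{\max}_i\mid B^{\max}_i\le b]$. When $\rho_i(b)=0$ this conditional expectation is undefined, and the product $\beta^{\max}_i(b)\rho_i(b)$ is interpreted as $0$, so that for all $b\ge 0$ and $r\in\mathbb{R}$, $[r-\beta^{\max}_i(b)]\rho_i(b)=\mathbb{E}[(r-B^{\max}_i)\mathbf{1}(B^{\max}_i\le b)]$. No further assumptions are made on the distribution of $B^{\max}_i$. For each $(i,k)\in\mathcal{E}$, $r_{ik}:=q_k\theta_{ik}\ge 0$, where $q_k>0$ is the cost-per-click price of campaign $k$ and $\theta_{ik}\in[0,1]$ is a click-through rate. Vector inequalities are componentwise. Let $\mathcal{S}:=\{\mathbf{x}\in\mathbb{R}^{|\mathcal{E}|}:\sum_{k\in\mathcal{K}_i}x_{ik}\le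 1\ \text{for all } i\in\mathcal{I},\ \mathbf{x}\ge 0\}$ and $$\pi(\mathbf{x},\mathbf{b}):=\sum_{(i,k)\in\mathcal{E}}[r_{ik}-\beta^{\max}_i(b_{ik})]\,s_i\,x_{ik}\,\rho_i(b_{ik}).$$ Primal problem (P): maximize $\pi(\mathbf{x},\mathbf{b})$ over $\mathbf{x},\mathbf{b}\in\mathbb{R}^{|\mathcal{E}|}$ subject to $\sum_{i\in\mathcal{I}_k}r_{ik}s_ix_{ik}\rho_i(b_{ik})\le m_k$ for all $k\in\mathcal{K}$, $\ \mathbf{x}\in\mathcal{S}$, and $\mathbf{b}\ge 0$. Its optimal value $P^\ast$ is the supremum of $\pi$ over the feasible set. Lagrangian: for $\lambda\in\mathbb{R}^{|\mathcal{K}|}$, $$L(\mathbf{x},\mathbf{b},\lambda):=\sum_{(i,k)\in\mathcal{E}}[r_{ik}-\beta^{\max}_i(b_{ik})]s_ix_{ik}\rho_i(b_{ik})+\sum_{k\in\mathcal{K}}\lambda_k\Big[m_k-\sum_{i\in\mathcal{I}_k}r_{ik}s_ix_{ik}\rho_i(b_{ik})\Big].$$ Dual function: $L^\ast(\lambda):=\max_{\mathbf{x}\in\mathcal{S},\,\mathbf{b}\ge 0}L(\mathbf{x},\mathbf{b},\lambda)$ (a priori a supremum). Dual problem (D): minimize $L^\ast(\lambda)$ over $\lambda\in\mathbb{R}^{|\mathcal{K}|}$ subject to $0\le\lambda_k\le 1$ for all $k\in\mathcal{K}$. Its optimal value $D^\ast$ is the infimum of $L^\ast$ over this box. For a convex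 function $f:\mathbb{R}^n\to\mathbb{R}$, $\partial f(x)$ denotes the set of vectors $g$ such that $f(y)\ge f(x)+g^T(y-x)$ for all $y\in\mathbb{R}^n$. Subgradient procedure. Input: $\lambda\in\mathbb{R}^{|\mathcal{K}|}$ with $0\le\lambda_k\le 1$ for all $k$. Step 1: for each $(i,k)\in\mathcal{E}$ set $b^\ast(\lambda)_{ik}:=(1-\lambda_k)r_{ik}$ and $\pi(\lambda)_{ik}:=[b^\ast(\lambda)_{ik}-\beta^{\max}_i(b^\ast(\lambda)_{ik})]\,s_i\,\rho_i(b^\ast(\lambda)_{ik})$. Step 2: compute $\mathbf{x}^\ast(\lambda)\in\arg\max_{\mathbf{x}\in\mathcal{S}}\{\sum_{(i,k)\in\mathcal{E}}\pi(\lambda)_{ik}x_{ik}\}$ by the greedy algorithm: for each $i\in\mathcal{I}$ (with $\mathcal{K}_i\ne\emptyset$) choose $k^\ast(i)\in\arg\max_{k\in\mathcal{K}_i}\pi(\lambda)_{ik}$ (ties broken arbitrarily), set $x^\ast(\lambda)_{ik^\ast(i)}:=\mathbf{1}(\pi(\lambda)_{ik^\ast(i)}>0)$, and set $x^\ast(\lambda)_{ik}:=0$ for all other $k\in\mathcal{K}_i$. Here $\mathbf{1}(\cdot)$ equals $1$ if its argument is true and $0$ otherwise. Step 3: for each $k\in\mathcal{K}$ set $g(\lambda)_k:=m_k-\sum_{i\in\mathcal{I}_k}r_{ik}s_ix^\ast(\lambda)_{ik}\rho_i(b^\ast(\lambda)_{ik})$. Output: $g(\lambda)$. *)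

theory Defs
  imports "HOL-Probability.Probability"
begin

text \<open>
  Impression types and campaigns are the elements of finite types \<open>'i\<close> and \<open>'k\<close>. The random
  variables \<open>bmax i\<close> live on a common probability space \<open>pspace\<close>; only their marginal
  distributions matter. The click-through rates \<open>ctr i k\<close> are meaningful only for pairs in
  \<open>edges\<close>.
\<close>

record ('i, 'k, 'w) market =
  targets  :: "'k \<Rightarrow> 'i set"            \<comment> \<open>\<open>I\<^sub>k\<close>\<close>
  budget   :: "'k \<Rightarrow> real"              \<comment> \<open>\<open>m\<^sub>k\<close>\<close>
  arrivals :: "'i \<Rightarrow> real"              \<comment> \<open>\<open>s\<^sub>i\<close>\<close>
  pspace   :: "'w measure"
  bmax     :: "'i \<Rightarrow> 'w \<Rightarrow> real"
  price    :: "'k \<Rightarrow> real"              \<comment> \<open>\<open>q\<^sub>k\<close>\<close>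
  ctr      :: "'i \<Rightarrow> 'k \<Rightarrow> real"        \<comment> \<open>\<open>\<theta>\<^sub>i\<^sub>k\<close>\<close>

definition edges :: "('i, 'k, 'w) market \<Rightarrow> ('i \<times> 'k) set" where
  "edges A = {(i, k). i \<in> targets A k}"

definition campaigns_of :: "('i, 'k, 'w) market \<Rightarrow> 'i \<Rightarrow> 'k set" where
  "campaigns_of A i = {k. (i, k) \<in> edges A}"

definition unit_rev :: "('i, 'k, 'w) market \<Rightarrow> 'i \<Rightarrow> 'k \<Rightarrow> real" where
  "unit_rev A i k = price A k * ctr A i k"

definition rho :: "('i, 'k, 'w) market \<Rightarrow> 'i \<Rightarrow> real \<Rightarrow> real" where
  "rho A i b = measure (pspace A) {w \<in> space (pspace A). bmax A i w \<le> b}"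

text \<open>
  The elementary conditional expectation of \<open>bmax i\<close> given the event \<open>bmax i \<le> b\<close>. If that event
  has probability zero the value is \<open>0\<close> by the convention for division by zero; \<open>beta\<close> is only
  ever used multiplied by \<open>rho\<close>, which vanishes in this case.
\<close>

definition beta :: "('i, 'k, 'w) market \<Rightarrow> 'i \<Rightarrow> real \<Rightarrow> real" where
  "beta A i b =
     (LINT w : {w \<in> space (pspace A). bmax A i w \<le> b} | pspace A. bmax A i w) / rho A i b"

lemma beta_rho:
  fixes A :: "('i, 'k, 'w) market"
  assumes "prob_space (pspace A)" and [measurable]: "bmax A i \<in> borel_measurable (pspace A)"
   and "AE w in pspace A. bmax A i w > 0"
  shows "(r - beta A i b) * rho A i b
    = (LINT w|pspace A. (r - bmax A i w) * indicator {w. bmax A i w \<le> b} w)"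
proof -
  interpret prob_space "pspace A" by fact
  let ?S = "{w \<in> space (pspace A). bmax A i w \<le> b}"
  let ?f = "\<lambda>w. indicator ?S w * bmax A i w"
  have int: "integrable (pspace A) ?f"
    by (rule integrable_const_bound[of _ "\<bar>b\<bar>"]) (use assms(3) in \<open>auto simp: indicator_def elim!: eventually_mono\<close>)
  have ii: "integrable (pspace A) (\<lambda>w. r * indicator ?S w)" by (auto intro!: integrable_real_mult_indicator simp: emeasure_eq_measure)
  have eq: "beta A i b * rho A i b = (LINT w|pspace A. ?f w)"
  proof (cases "rho A i b = 0")
    case True
    then have "AE w in pspace A. w \<notin> ?S" 
      by (subst (asm) rho_def, subst (asm) prob_eq_0) auto
    then have "(LINT w|pspace A. ?f w) = (LINT w|pspace A. 0)"
      by (intro integral_cong_AE) (auto elim!: eventually_mono)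
    with True show ?thesis by simp
  qed (simp add: beta_def set_lebesgue_integral_def)
  have "(LINT w|pspace A. (r - bmax A i w) * indicator {w. bmax A i w \<le> b} w)
     = (LINT w|pspace A. r * indicator ?S w - ?f w)"
    by (intro Bochner_Integration.integral_cong) (auto simp: indicator_def)
  also have "... = r * rho A i b - beta A i b * rho A i b"
    using int ii by (simp add: eq) (simp add: rho_def)
  finally show ?thesis by (simp add: algebra_simps)
qed

text \<open>
  Vectors indexed by \<open>edges\<close> are represented by functions \<open>'i \<Rightarrow> 'k \<Rightarrow> real\<close>, which are
  constrained and evaluated on \<open>edges\<close> only.
\<close>

definition allocations :: "('i, 'k, 'w) market \<Rightarrow> ('i \<Rightarrow> 'k \<Rightarrow> real) set" where
  "allocations A =
     {x. (\<forall>i. (\<Sum>k\<in>campaigns_of A i. x i k) \<le> 1) \<and> (\<forall>(i, k)\<in>edges A. 0 \<le> x i k)}"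

definition bids :: "('i, 'k, 'w) market \<Rightarrow> ('i \<Rightarrow> 'k \<Rightarrow> real) set" where
  "bids A = {b. \<forall>(i, k)\<in>edges A. 0 \<le> b i k}"

definition profit ::
    "('i, 'k, 'w) market \<Rightarrow> ('i \<Rightarrow> 'k \<Rightarrow> real) \<Rightarrow> ('i \<Rightarrow> 'k \<Rightarrow> real) \<Rightarrow> real" where
  "profit A x b =
     (\<Sum>(i, k)\<in>edges A.
        (unit_rev A i k - beta A i (b i k)) * arrivals A i * x i k * rho A i (b i k))"

definition spend ::
    "('i, 'k, 'w) market \<Rightarrow> ('i \<Rightarrow> 'k \<Rightarrow> real) \<Rightarrow> ('i \<Rightarrow> 'k \<Rightarrow> real) \<Rightarrow> 'k \<Rightarrow> real" where
  "spend A x b k = (\<Sum>i\<in>targets A k. unit_rev A i k * arrivals A i * x i k * rho A i (b i k))"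

definition primal_feasible ::
    "('i, 'k, 'w) market \<Rightarrow> (('i \<Rightarrow> 'k \<Rightarrow> real) \<times> ('i \<Rightarrow> 'k \<Rightarrow> real)) set" where
  "primal_feasible A =
     {(x, b). (\<forall>k. spend A x b k \<le> budget A k) \<and> x \<in> allocations A \<and> b \<in> bids A}"

text \<open>
  Optimal values and the dual function are taken in the extended reals, so that no finiteness is
  built into their definitions.
\<close>

definition primal_value :: "('i, 'k, 'w) market \<Rightarrow> ereal" where
  "primal_value A = (SUP (x, b)\<in>primal_feasible A. ereal (profit A x b))"

definition lagrangian ::
    "('i, 'k::finite, 'w) market \<Rightarrow> ('i \<Rightarrow> 'k \<Rightarrow> real) \<Rightarrow> ('i \<Rightarrow> 'k \<Rightarrow> real) \<Rightarrow> real ^ 'k \<Rightarrow> real"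
  where
  "lagrangian A x b l = profit A x b + (\<Sum>k\<in>UNIV. l $ k * (budget A k - spend A x b k))"

definition dual_fun :: "('i, 'k::finite, 'w) market \<Rightarrow> real ^ 'k \<Rightarrow> ereal" where
  "dual_fun A l = (SUP (x, b)\<in>allocations A \<times> bids A. ereal (lagrangian A x b l))"

definition dual_feasible :: "(real ^ 'k) set" where
  "dual_feasible = {l. \<forall>k. 0 \<le> l $ k \<and> l $ k \<le> 1}"

definition dual_value :: "('i, 'k::finite, 'w) market \<Rightarrow> ereal" where
  "dual_value A = (INF l\<in>dual_feasible. dual_fun A l)"

definition subdifferential :: "('a::real_inner \<Rightarrow> real) \<Rightarrow> 'a \<Rightarrow> 'a set" where
  "subdifferential f x = {g. \<forall>y. f y \<ge> f x + g \<bullet> (y - x)}"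

definition bstar :: "('i, 'k::finite, 'w) market \<Rightarrow> real ^ 'k \<Rightarrow> 'i \<Rightarrow> 'k \<Rightarrow> real" where
  "bstar A l i k = (1 - l $ k) * unit_rev A i k"

definition pi_dual :: "('i, 'k::finite, 'w) market \<Rightarrow> real ^ 'k \<Rightarrow> 'i \<Rightarrow> 'k \<Rightarrow> real" where
  "pi_dual A l i k =
     (bstar A l i k - beta A i (bstar A l i k)) * arrivals A i * rho A i (bstar A l i k)"

definition greedy_choice :: "('i, 'k::finite, 'w) market \<Rightarrow> real ^ 'k \<Rightarrow> ('i \<Rightarrow> 'k) \<Rightarrow> bool" where
  "greedy_choice A l kst \<longleftrightarrow>
     (\<forall>i. campaigns_of A i \<noteq> {} \<longrightarrow>
        is_arg_max (pi_dual A l i) (\<lambda>k. k \<in> campaigns_of A i) (kst i))"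

definition xstar ::
    "('i, 'k::finite, 'w) market \<Rightarrow> real ^ 'k \<Rightarrow> ('i \<Rightarrow> 'k) \<Rightarrow> 'i \<Rightarrow> 'k \<Rightarrow> real" where
  "xstar A l kst i k = (if k = kst i then of_bool (pi_dual A l i (kst i) > 0) else 0)"

text \<open>
  All possible outputs of the subgradient procedure on input \<open>l\<close>, one for each way of breaking ties
  in the greedy step.
\<close>

definition subgradient_outputs :: "('i, 'k::finite, 'w) market \<Rightarrow> real ^ 'k \<Rightarrow> (real ^ 'k) set" where
  "subgradient_outputs A l =
     {\<chi> k. budget A k - spend A (xstar A l kst) (bstar A l) k | kst. greedy_choice A l kst}"

lemma subgradient_outputs_nonempty: "subgradient_outputs A l \<noteq> {}"
proof -
  have "\<exists>k. is_arg_max (pi_dual A l i) (\<lambda>k. k \<in> campaigns_of A i) k"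
    if "campaigns_of A i \<noteq> {}" for i
  proof -
    let ?V = "pi_dual A l i ` campaigns_of A i"
    have "Max ?V \<in> ?V"
      using that by simp
    then obtain k where "k \<in> campaigns_of A i" "pi_dual A l i k = Max ?V"
      by force
    then show ?thesis
      by (auto simp: is_arg_max_def not_less intro!: exI[of _ k])
  qed
  then have "\<exists>kst. greedy_choice A l kst"
    unfolding greedy_choice_def by metis
  then show ?thesis
    unfolding subgradient_outputs_def by blast
qed

end

theory Submission
  imports Defs
begin

text \<open>
  Collecting the terms of the Lagrangian edge by edge gives
  \[ L(x, b, \lambda) = \sum_k \lambda_k m_k +
       \sum_{(i, k)} s_i x_{ik} E[((1 - \lambda_k) r_{ik} - B_i) 1(B_i \le b_{ik})] \]
  (lemma \<open>lagrangian_edgewise\<close>): the multiplier \<open>\<lambda>\<^sub>k\<close> merely discounts the revenue of campaign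
  \<open>k\<close>. Hence the maximisation over bids and allocations can be done in two independent stages.

  First, for a discounted revenue \<open>r\<close> the expectation is largest for the bid \<open>b = r\<close>, as in a
  second-price auction: the integrand \<open>(r - B) 1(B \<le> b)\<close> never exceeds \<open>max 0 (r - B)\<close>, which is
  its value at \<open>b = r\<close> (lemma \<open>surplus_le_truthful\<close>). The inequality holds for \<open>r\<close> of
  either sign, so \<open>L\<close> is bounded above for every multiplier, and \<open>L\<^sup>*\<close> is finite everywhere. When
  \<open>\<lambda> \<le> 1\<close>, the truthful bids also satisfy the constraint \<open>b \<ge> 0\<close>, so the bound is attained.
  Secondly, with the bids fixed, the objective is linear in \<open>x\<close> and splits over the impression
  types; on each subprobability vector a linear form is maximised by the greedy choice.

  For fixed \<open>(x, b)\<close> the Lagrangian is affine in \<open>\<lambda>\<close>, with gradient equal to the vector of unspent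
  budgets. So \<open>L\<^sup>*\<close>, a finite supremum of affine functions, is convex, and the gradient at any
  maximiser \<open>(x, b)\<close> of \<open>L(\<cdot>, \<cdot>, \<lambda>)\<close> is a subgradient of \<open>L\<^sup>*\<close> at \<open>\<lambda>\<close>. The procedure outputs
  this gradient at the maximiser found above. The inequalities between the optimal values are weak
  duality.
\<close>

section \<open>Suprema of families of functions\<close>

lemma real_of_ereal_SUP_upper:
  fixes f :: "'a \<Rightarrow> real"
  assumes "\<bar>SUP j\<in>J. ereal (f j)\<bar> \<noteq> \<infinity>" and "j \<in> J"
  shows "f j \<le> real_of_ereal (SUP j\<in>J. ereal (f j))"
proof -
  have "ereal (f j) \<le> (SUP j\<in>J. ereal (f j))"
    using assms(2) by (rule SUP_upper)
  then show ?thesis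
    using assms(1) by (simp add: ereal_le_real_iff)
qed

lemma real_of_ereal_SUP_least:
  fixes f :: "'a \<Rightarrow> real"
  assumes "\<bar>SUP j\<in>J. ereal (f j)\<bar> \<noteq> \<infinity>" and "\<And>j. j \<in> J \<Longrightarrow> f j \<le> u"
  shows "real_of_ereal (SUP j\<in>J. ereal (f j)) \<le> u"
proof -
  have "(SUP j\<in>J. ereal (f j)) \<le> ereal u"
    using assms(2) by (intro SUP_least) simp
  then show ?thesis
    using assms(1) by (simp add: real_le_ereal_iff)
qed

lemma convex_on_SUP:
  fixes h :: "'j \<Rightarrow> 'a::real_vector \<Rightarrow> real"
  assumes finite_SUP: "\<And>y. \<bar>SUP j\<in>J. ereal (h j y)\<bar> \<noteq> \<infinity>"
    and convex: "\<And>j. j \<in> J \<Longrightarrow> convex_on UNIV (h j)"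
  shows "convex_on UNIV (\<lambda>y. real_of_ereal (SUP j\<in>J. ereal (h j y)))" (is "convex_on UNIV ?F")
proof (rule convex_onI)
  fix t :: real and x y :: 'a
  assume t: "0 < t" "t < 1"
  show "?F ((1 - t) *\<^sub>R x + t *\<^sub>R y) \<le> (1 - t) * ?F x + t * ?F y"
  proof (rule real_of_ereal_SUP_least[OF finite_SUP])
    fix j assume j: "j \<in> J"
    have "h j ((1 - t) *\<^sub>R x + t *\<^sub>R y) \<le> (1 - t) * h j x + t * h j y"
      using convex_onD[OF convex[OF j]] t by simp
    also have "\<dots> \<le> (1 - t) * ?F x + t * ?F y"
      using t real_of_ereal_SUP_upper[OF finite_SUP j]
      by (intro add_mono mult_left_mono) auto
    finally show "h j ((1 - t) *\<^sub>R x + t *\<^sub>R y) \<le> (1 - t) * ?F x + t * ?F y" .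
  qed
qed simp

lemma convex_on_affine:
  fixes h :: "'a::real_inner \<Rightarrow> real"
  assumes "\<And>x y. h y = h x + g \<bullet> (y - x)"
  shows "convex_on UNIV h"
proof (rule convex_onI)
  fix t :: real and x y :: 'a
  obtain c where "h z = c + g \<bullet> z" for z
  proof
    show "h z = h 0 + g \<bullet> z" for z
      using assms[of z 0] by simp
  qed
  then show "h ((1 - t) *\<^sub>R x + t *\<^sub>R y) \<le> (1 - t) * h x + t * h y"
    by (simp add: algebra_simps)
qed simp

section \<open>The Lagrangian, edge by edge\<close>

text \<open>
  The expected gain \<open>E[(r - B) 1(B \<le> b)]\<close> from bidding \<open>b\<close> on an impression that is worth \<open>r\<close>, if
  the winner pays the highest competing bid \<open>B = bmax A i\<close>; see \<open>surplus_eq_integral\<close>.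
\<close>

definition surplus :: "('i, 'k, 'w) market \<Rightarrow> 'i \<Rightarrow> real \<Rightarrow> real \<Rightarrow> real" where
  "surplus A i r b = (r - beta A i b) * rho A i b"

lemma sum_edges_by_impression:
  fixes A :: "('i::finite, 'k::finite, 'w) market"
  shows "(\<Sum>(i, k)\<in>edges A. f i k) = (\<Sum>i\<in>UNIV. \<Sum>k\<in>campaigns_of A i. f i k)"
proof -
  have "edges A = Sigma UNIV (campaigns_of A)"
    by (auto simp: campaigns_of_def)
  then show ?thesis
    by (simp add: sum.Sigma)
qed

lemma sum_edges_by_campaign:
  fixes A :: "('i::finite, 'k::finite, 'w) market"
  shows "(\<Sum>(i, k)\<in>edges A. f i k) = (\<Sum>k\<in>UNIV. \<Sum>i\<in>targets A k. f i k)"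
proof -
  have "campaigns_of A i = {k. i \<in> targets A k}" for i
    by (simp add: campaigns_of_def edges_def)
  then show ?thesis
    using sum.swap_restrict[of UNIV UNIV f "\<lambda>i k. i \<in> targets A k"]
    by (simp add: sum_edges_by_impression)
qed

text \<open>
  Profit and spending on an edge carry the same factor \<open>arrivals A i * x i k * rho A i (b i k)\<close>, so
  a multiplier on spending acts as a discount of the revenue, which is what \<open>bstar\<close> computes.
\<close>

lemma lagrangian_edgewise:
  fixes A :: "('i::finite, 'k::finite, 'w) market"
  shows "lagrangian A x b l = (\<Sum>k\<in>UNIV. l $ k * budget A k) +
    (\<Sum>(i, k)\<in>edges A. x i k * (arrivals A i * surplus A i (bstar A l i k) (b i k)))"
proof -
  have "(\<Sum>k\<in>UNIV. l $ k * spend A x b k) =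
      (\<Sum>(i, k)\<in>edges A. l $ k * (unit_rev A i k * arrivals A i * x i k * rho A i (b i k)))"
    by (simp add: sum_edges_by_campaign spend_def sum_distrib_left)
  then have "lagrangian A x b l = (\<Sum>k\<in>UNIV. l $ k * budget A k) +
      (\<Sum>(i, k)\<in>edges A.
        (unit_rev A i k - beta A i (b i k)) * arrivals A i * x i k * rho A i (b i k) -
        l $ k * (unit_rev A i k * arrivals A i * x i k * rho A i (b i k)))"
    by (simp add: lagrangian_def profit_def right_diff_distrib sum_subtractf case_prod_unfold)
  also have "(\<Sum>(i, k)\<in>edges A.
        (unit_rev A i k - beta A i (b i k)) * arrivals A i * x i k * rho A i (b i k) -
        l $ k * (unit_rev A i k * arrivals A i * x i k * rho A i (b i k))) =
      (\<Sum>(i, k)\<in>edges A. x i k * (arrivals A i * surplus A i (bstar A l i k) (b i k)))"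
    by (intro sum.cong) (auto simp: surplus_def bstar_def algebra_simps)
  finally show ?thesis .
qed

lemma pi_dual_eq_surplus:
  "pi_dual A l i k = arrivals A i * surplus A i (bstar A l i k) (bstar A l i k)"
  by (simp add: pi_dual_def surplus_def)

lemma lagrangian_affine:
  fixes A :: "('i, 'k::finite, 'w) market"
  shows "lagrangian A x b y =
    lagrangian A x b l + (\<chi> k. budget A k - spend A x b k) \<bullet> (y - l)"
proof -
  have "lagrangian A x b z = profit A x b + (\<chi> k. budget A k - spend A x b k) \<bullet> z" for z
    by (simp add: lagrangian_def inner_vec_def mult.commute)
  then show ?thesis
    by (simp add: inner_diff_right)
qed

lemma convex_on_lagrangian:
  fixes A :: "('i, 'k::finite, 'w) market"
  shows "convex_on UNIV (lagrangian A x b)"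
  by (rule convex_on_affine[where g = "\<chi> k. budget A k - spend A x b k"])
    (rule lagrangian_affine)

lemma dual_fun_eq_SUP:
  "dual_fun A l =
    (SUP p\<in>allocations A \<times> bids A. ereal (lagrangian A (fst p) (snd p) l))"
  by (simp add: dual_fun_def case_prod_unfold)

lemma lagrangian_le_dual_fun:
  assumes "x \<in> allocations A" and "b \<in> bids A"
  shows "ereal (lagrangian A x b l) \<le> dual_fun A l"
  unfolding dual_fun_def using assms by (intro SUP_upper2[of "(x, b)"]) auto

lemma allocation_nonneg:
  assumes "x \<in> allocations A" and "k \<in> campaigns_of A i"
  shows "0 \<le> x i k"
  using assms by (auto simp: allocations_def campaigns_of_def)

lemma allocation_sum_le_1:
  assumes "x \<in> allocations A"
  shows "(\<Sum>k\<in>campaigns_of A i. x i k) \<le> 1"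
  using assms by (simp add: allocations_def)

lemma xstar_in_allocations:
  fixes A :: "('i, 'k::finite, 'w) market"
  shows "xstar A l kst \<in> allocations A"
  by (auto simp: allocations_def xstar_def sum.delta)

section \<open>Maximising the Lagrangian\<close>

locale ad_market =
  fixes A :: "('i::finite, 'k::finite, 'w) market"
  assumes prob_space_pspace: "prob_space (pspace A)"
    and bmax_measurable [measurable]: "\<And>i. bmax A i \<in> borel_measurable (pspace A)"
    and bmax_pos: "\<And>i. AE w in pspace A. bmax A i w > 0"
    and arrivals_nonneg: "\<And>i. arrivals A i \<ge> 0"
    and unit_rev_nonneg: "\<And>i k. (i, k) \<in> edges A \<Longrightarrow> 0 \<le> unit_rev A i k"
begin

interpretation prob_space "pspace A"
  by (rule prob_space_pspace)

lemma surplus_eq_integral: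
  "surplus A i r b = (LINT w|pspace A. (r - bmax A i w) * indicator {w. bmax A i w \<le> b} w)"
  unfolding surplus_def by (rule beta_rho[OF prob_space_pspace bmax_measurable bmax_pos])

text \<open>
  \<open>bmax\<close> itself need not be integrable; on the event that the bid wins it almost surely lies
  between \<open>0\<close> and \<open>b\<close>.
\<close>

lemma integrable_surplus:
  "integrable (pspace A) (\<lambda>w. (r - bmax A i w) * indicator {w. bmax A i w \<le> b} w)"
proof (rule integrable_const_bound)
  show "AE w in pspace A. norm ((r - bmax A i w) * indicator {w. bmax A i w \<le> b} w) \<le> \<bar>r\<bar> + \<bar>b\<bar>"
    using bmax_pos[of i] by eventually_elim (auto simp: indicator_def)
qed measurable

text \<open>
  A truthful bid wins exactly when winning is worthwhile, so it beats any other bid in every outcome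
  and not only on average.
\<close>

lemma surplus_le_truthful: "surplus A i r b \<le> surplus A i r r"
  unfolding surplus_eq_integral
  by (intro integral_mono integrable_surplus) (auto simp: indicator_def)

lemma surplus_truthful_nonneg: "0 \<le> surplus A i r r"
  unfolding surplus_eq_integral
  by (intro Bochner_Integration.integral_nonneg) (auto simp: indicator_def)

lemma pi_dual_nonneg: "0 \<le> pi_dual A l i k"
  by (simp add: pi_dual_eq_surplus arrivals_nonneg surplus_truthful_nonneg)

text \<open>
  Truthful bids are best on each edge separately, and an allocation weights the edges
  nonnegatively.
\<close>

lemma lagrangian_le_truthful:
  assumes "x \<in> allocations A"
  shows "lagrangian A x b l \<le> lagrangian A x (bstar A l) l"
  unfolding lagrangian_edgewise sum_edges_by_impression
  by (intro add_left_mono sum_mono mult_left_mono surplus_le_truthful)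
    (simp_all add: arrivals_nonneg allocation_nonneg[OF assms])

lemma lagrangian_truthful:
  "lagrangian A x (bstar A l) l = (\<Sum>k\<in>UNIV. l $ k * budget A k) +
    (\<Sum>i\<in>UNIV. \<Sum>k\<in>campaigns_of A i. x i k * pi_dual A l i k)"
  by (simp add: lagrangian_edgewise sum_edges_by_impression pi_dual_eq_surplus)

text \<open>
  The weights \<open>x i k\<close> of one impression type may add up to less than \<open>1\<close>; the missing weight counts
  as value \<open>0\<close>, so the bound \<open>u\<close> has to be nonnegative.
\<close>

lemma allocation_value_le:
  assumes x: "x \<in> allocations A"
    and bound: "\<And>k. k \<in> campaigns_of A i \<Longrightarrow> pi_dual A l i k \<le> u" and "0 \<le> u"
  shows "(\<Sum>k\<in>campaigns_of A i. x i k * pi_dual A l i k) \<le> u"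
proof -
  have "(\<Sum>k\<in>campaigns_of A i. x i k * pi_dual A l i k) \<le> (\<Sum>k\<in>campaigns_of A i. x i k) * u"
    unfolding sum_distrib_right
    by (intro sum_mono mult_left_mono bound allocation_nonneg[OF x])
  also have "\<dots> \<le> u"
    using mult_right_mono[OF allocation_sum_le_1[OF x] \<open>0 \<le> u\<close>] by simp
  finally show ?thesis .
qed

text \<open>
  The greedy rule allocates nothing when the best value is not positive; by \<open>pi_dual_nonneg\<close> that
  value is then \<open>0\<close>, so nothing is lost.
\<close>

lemma greedy_value:
  assumes "greedy_choice A l kst" and "campaigns_of A i \<noteq> {}"
  shows "(\<Sum>k\<in>campaigns_of A i. xstar A l kst i k * pi_dual A l i k) = pi_dual A l i (kst i)"
proof -
  have kst: "kst i \<in> campaigns_of A i"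
    using assms by (auto simp: greedy_choice_def is_arg_max_def)
  have "(\<Sum>k\<in>campaigns_of A i. xstar A l kst i k * pi_dual A l i k) =
      (\<Sum>k\<in>campaigns_of A i. if k = kst i then pi_dual A l i k else 0)"
    using pi_dual_nonneg[of l i] by (intro sum.cong) (auto simp: xstar_def less_le)
  then show ?thesis
    using kst by simp
qed

lemma greedy_optimal:
  assumes x: "x \<in> allocations A" and greedy: "greedy_choice A l kst"
  shows "(\<Sum>k\<in>campaigns_of A i. x i k * pi_dual A l i k) \<le>
    (\<Sum>k\<in>campaigns_of A i. xstar A l kst i k * pi_dual A l i k)"
proof (cases "campaigns_of A i = {}")
  case False
  then have "pi_dual A l i k \<le> pi_dual A l i (kst i)" if "k \<in> campaigns_of A i" for k
    using greedy that by (auto simp: greedy_choice_def is_arg_max_def not_less)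
  then show ?thesis
    using allocation_value_le[OF x _ pi_dual_nonneg]
    by (simp add: greedy_value[OF greedy False])
qed simp

lemma lagrangian_le_greedy:
  assumes "x \<in> allocations A" and "greedy_choice A l kst"
  shows "lagrangian A x b l \<le> lagrangian A (xstar A l kst) (bstar A l) l"
proof -
  have "lagrangian A x b l \<le> lagrangian A x (bstar A l) l"
    by (rule lagrangian_le_truthful[OF assms(1)])
  also have "\<dots> \<le> lagrangian A (xstar A l kst) (bstar A l) l"
    unfolding lagrangian_truthful by (intro add_left_mono sum_mono greedy_optimal assms)
  finally show ?thesis .
qed

lemma bstar_in_bids:
  assumes "\<And>k. l $ k \<le> 1"
  shows "bstar A l \<in> bids A"
  using assms unit_rev_nonneg by (auto simp: bids_def bstar_def)

section \<open>The dual function\<close>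

text \<open>
  The greedy pair bounds the Lagrangian for every \<open>l\<close>, although its bids may be negative
  where \<open>l\<close> exceeds \<open>1\<close>.
\<close>

lemma dual_fun_finite: "\<bar>dual_fun A l\<bar> \<noteq> \<infinity>"
proof -
  obtain kst where kst: "greedy_choice A l kst"
    using subgradient_outputs_nonempty[of A l] by (auto simp: subgradient_outputs_def)
  have "dual_fun A l \<le> ereal (lagrangian A (xstar A l kst) (bstar A l) l)"
    unfolding dual_fun_def using lagrangian_le_greedy[OF _ kst] by (intro SUP_least) auto
  moreover have "ereal (lagrangian A (\<lambda>_ _. 0) (\<lambda>_ _. 0) l) \<le> dual_fun A l"
    by (rule lagrangian_le_dual_fun) (auto simp: allocations_def bids_def)
  ultimately show ?thesis
    by auto
qed

lemma convex_on_dual_fun: "convex_on UNIV (\<lambda>l. real_of_ereal (dual_fun A l))"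
  unfolding dual_fun_eq_SUP
proof (rule convex_on_SUP)
  show "\<bar>SUP p\<in>allocations A \<times> bids A. ereal (lagrangian A (fst p) (snd p) l)\<bar> \<noteq> \<infinity>" for l
    by (rule dual_fun_finite[unfolded dual_fun_eq_SUP])
  show "convex_on UNIV (lagrangian A (fst p) (snd p))" for p
    by (rule convex_on_lagrangian)
qed

lemma lagrangian_le_real_dual_fun:
  assumes "x \<in> allocations A" and "b \<in> bids A"
  shows "lagrangian A x b l \<le> real_of_ereal (dual_fun A l)"
  using lagrangian_le_dual_fun[OF assms] dual_fun_finite by (simp add: ereal_le_real_iff)

lemma dual_fun_greedy:
  assumes "\<And>k. l $ k \<le> 1" and "greedy_choice A l kst"
  shows "real_of_ereal (dual_fun A l) = lagrangian A (xstar A l kst) (bstar A l) l"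
proof (rule antisym)
  show "real_of_ereal (dual_fun A l) \<le> lagrangian A (xstar A l kst) (bstar A l) l"
    unfolding dual_fun_eq_SUP
    by (rule real_of_ereal_SUP_least[OF dual_fun_finite[unfolded dual_fun_eq_SUP]])
      (auto intro: lagrangian_le_greedy[OF _ assms(2)])
  show "lagrangian A (xstar A l kst) (bstar A l) l \<le> real_of_ereal (dual_fun A l)"
    by (rule lagrangian_le_real_dual_fun[OF xstar_in_allocations bstar_in_bids[OF assms(1)]])
qed

text \<open>
  The affine function \<open>lagrangian A x b\<close> with \<open>(x, b)\<close> the greedy pair at \<open>l\<close> lies below the dual
  function and touches it at \<open>l\<close>; the output of the procedure is its slope.
\<close>

lemma subgradient_outputs_valid:
  assumes l: "\<And>k. l $ k \<le> 1" and "g \<in> subgradient_outputs A l"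
  shows "g \<in> subdifferential (\<lambda>l. real_of_ereal (dual_fun A l)) l"
proof -
  obtain kst where kst: "greedy_choice A l kst"
    and g: "g = (\<chi> k. budget A k - spend A (xstar A l kst) (bstar A l) k)"
    using assms(2) by (auto simp: subgradient_outputs_def)
  have "real_of_ereal (dual_fun A l) + g \<bullet> (y - l) \<le> real_of_ereal (dual_fun A y)" for y
    using lagrangian_le_real_dual_fun[OF xstar_in_allocations bstar_in_bids[OF l]]
    unfolding dual_fun_greedy[OF l kst] g lagrangian_affine[symmetric] .
  then show ?thesis
    by (simp add: subdifferential_def)
qed

end

section \<open>Weak duality\<close>

text \<open>
  A multiplier \<open>l \<ge> 0\<close> turns the slack of a budget constraint into a nonnegative bonus in the
  Lagrangian.
\<close>

lemma profit_le_dual_fun: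
  assumes "(x, b) \<in> primal_feasible A" and "\<And>k. 0 \<le> l $ k"
  shows "ereal (profit A x b) \<le> dual_fun A l"
proof -
  have "0 \<le> (\<Sum>k\<in>UNIV. l $ k * (budget A k - spend A x b k))"
    using assms by (intro sum_nonneg mult_nonneg_nonneg) (auto simp: primal_feasible_def)
  then have "ereal (profit A x b) \<le> ereal (lagrangian A x b l)"
    by (simp add: lagrangian_def)
  also have "\<dots> \<le> dual_fun A l"
    using assms(1) by (intro lagrangian_le_dual_fun) (auto simp: primal_feasible_def)
  finally show ?thesis .
qed

lemma primal_value_le_dual_value:
  fixes A :: "('i, 'k::finite, 'w) market"
  shows "primal_value A \<le> dual_value A"
  unfolding primal_value_def dual_value_def
proof (rule SUP_least, rule INF_greatest)
  fix p and l :: "real ^ 'k"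
  assume "p \<in> primal_feasible A" and "l \<in> dual_feasible"
  then show "(case p of (x, b) \<Rightarrow> ereal (profit A x b)) \<le> dual_fun A l"
    using profit_le_dual_fun[of "fst p" "snd p" A l]
    by (simp add: dual_feasible_def case_prod_unfold)
qed

theorem theorem4p1:
  fixes A :: "('i::finite, 'k::finite, 'w) market"
  assumes "prob_space (pspace A)"
    and "\<And>i. bmax A i \<in> borel_measurable (pspace A)"
    and "\<And>i. AE w in pspace A. bmax A i w > 0"
    and "\<And>k. budget A k \<ge> 0"
    and "\<And>i. arrivals A i \<ge> 0"
    and "\<And>k. price A k > 0"
    and "\<And>i k. (i, k) \<in> edges A \<Longrightarrow> 0 \<le> ctr A i k \<and> ctr A i k \<le> 1"
  shows "((\<forall>l. \<bar>dual_fun A l\<bar> \<noteq> \<infinity>) \<and> convex_on UNIV (\<lambda>l. real_of_ereal (dual_fun A l)))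
    \<and> (\<forall>l. (\<forall>k. 0 \<le> l $ k \<and> l $ k \<le> 1) \<longrightarrow>
         (\<forall>g\<in>subgradient_outputs A l. g \<in> subdifferential (\<lambda>l. real_of_ereal (dual_fun A l)) l))
    \<and> (\<forall>x b l. (x, b) \<in> primal_feasible A \<longrightarrow> l \<in> dual_feasible \<longrightarrow>
         ereal (profit A x b) \<le> primal_value A \<and> primal_value A \<le> dual_value A
           \<and> dual_value A \<le> dual_fun A l)"
proof -
  have "0 \<le> unit_rev A i k" if "(i, k) \<in> edges A" for i k
    unfolding unit_rev_def using assms(6)[of k] assms(7)[OF that] by (simp add: less_imp_le)
  then interpret ad_market A
    using assms(1,2,3,5) by (intro ad_market.intro)
  have "ereal (profit A x b) \<le> primal_value A" if "(x, b) \<in> primal_feasible A" for x b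
    unfolding primal_value_def using that by (intro SUP_upper2[of "(x, b)"]) auto
  moreover have "dual_value A \<le> dual_fun A l" if "l \<in> dual_feasible" for l
    unfolding dual_value_def using that by (rule INF_lower)
  ultimately show ?thesis
    by (simp add: dual_fun_finite convex_on_dual_fun subgradient_outputs_valid
        primal_value_le_dual_value)
qed

end
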